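(* Let $n\ge 1$ be an integer. If $n=2k$ is even, then $$\alpha(3,2k)=\sum_{i=0}^{k}\binom{n}{k-i,\,k-i,\,i,\,i}\binom{2i}{i}=\binom{n}{k}\sum_{i=0}^{k}\binom{k}{i}^2\binom{2i}{i}.$$ If $n=2k+1$ is odd, then $$\alpha(3,2k+1)=2\binom{n}{k}\sum_{i=0}^{k}\binom{k}{i}\left[\binom{2i+1}{i+1}\binom{k+1}{i}+2\binom{k+1}{i+1}\binom{2i+1}{i}\right].$$
   Context: For positive integers $m,n$, let $A(m,n)$ be the set of all $m\times n$ matrices with every entry in $\{1,-1\}$ such that every row sum and every column sum has absolute value at most $1$, and let $\alpha(m,n)=|A(m,n)|$. The notation $\binom{n}{a,b,c,d}$ denotes the multinomial coefficient $\frac{n!}{a!\,b!\,c!\,d!}$ (with $a+b+c+d=n$). *)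

theory Defs
  imports "Jordan_Normal_Form.Matrix"
begin

definition A :: "nat \<Rightarrow> nat \<Rightarrow> int mat set" where
  "A m n = {M \<in> carrier_mat m n.
     (\<forall>i<m. \<forall>j<n. M $$ (i, j) \<in> {1, -1}) \<and>
     (\<forall>i<m. \<bar>\<Sum>j<n. M $$ (i, j)\<bar> \<le> 1) \<and>
     (\<forall>j<n. \<bar>\<Sum>i<m. M $$ (i, j)\<bar> \<le> 1)}"

definition alpha :: "nat \<Rightarrow> nat \<Rightarrow> nat" where
  "alpha m n = card (A m n)"

(* Meaningful only for a + b + c + d = n, in which case the division is exact. *)
definition multinomial :: "nat \<Rightarrow> nat \<Rightarrow> nat \<Rightarrow> nat \<Rightarrow> nat \<Rightarrow> nat" where
  "multinomial n a b c d = fact n div (fact a * fact b * fact c * fact d)"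

end

theory Submission
  imports Defs
begin

text \<open>
  Fix the set \<open>X\<close> of columns where the first row is \<open>1\<close>. A column sum is \<open>\<plusminus>1\<close> iff the column is
  not constant, so outside the set of columns where rows two and three differ, both of them are
  forced by the first row. Hence the matrix is given by \<open>X\<close>, the sets \<open>I\<close>
  and \<open>J\<close> of columns inside and outside \<open>X\<close> where rows two and three differ, and the set
  \<open>T \<subseteq> I \<union> J\<close> where among those row two is \<open>1\<close>. The row conditions only involve the four
  cardinalities, which turns the count into a sum of products of binomial coefficients; the row
  conditions leave just \<open>card I = card J = card T\<close> when \<open>n\<close> is even and a few cases when \<open>n\<close> is odd.
\<close>

section \<open>Row sums in terms of cardinalities\<close>

text \<open>The row condition for a row of length \<open>n\<close> with \<open>s\<close> entries
  equal to 1: its sum is s - (n - s). Working over \<open>int\<close> avoids truncated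
  subtraction.\<close>

definition balanced :: "nat \<Rightarrow> nat \<Rightarrow> bool" where
  "balanced n s \<longleftrightarrow> \<bar>2 * int s - int n\<bar> \<le> 1"

lemma balanced_even: "balanced (2 * k) s \<longleftrightarrow> s = k"
  unfolding balanced_def by linarith

lemma balanced_odd: "balanced (2 * k + 1) s \<longleftrightarrow> s = k \<or> s = k + 1"
  unfolding balanced_def by linarith

lemma sum_signs:
  assumes "X \<subseteq> {..<n}"
  shows "(\<Sum>j<n. if j \<in> X then 1 else - 1) = 2 * int (card X) - int n"
proof -
  have "(\<Sum>j<n. if j \<in> X then 1 else - 1 :: int) = (\<Sum>j<n. 2 * of_bool (j \<in> X) - 1)"
    by (rule sum.cong) auto
  also have "\<dots> = 2 * int (card ({..<n} \<inter> X)) - int n"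
    by (simp add: sum_subtractf flip: sum_distrib_left)
  finally show ?thesis using assms by (simp add: Int_absorb1)
qed

section \<open>Matrices as triples of column sets\<close>

text \<open>The three sets are the positions of 1 in the three rows. Three signs sum to 3 or -3
  exactly when they agree: the empty intersection excludes 3, and the full union excludes -3 and
  keeps all sets inside \<open>{..<n}\<close>.\<close>

definition plus_sets :: "nat \<Rightarrow> (nat set \<times> nat set \<times> nat set) set" where
  "plus_sets n = {(X, Y, Z). X \<inter> Y \<inter> Z = {} \<and> X \<union> Y \<union> Z = {..<n} \<and>
     balanced n (card X) \<and> balanced n (card Y) \<and> balanced n (card Z)}"

definition sign_mat :: "nat \<Rightarrow> nat set \<times> nat set \<times> nat set \<Rightarrow> int mat" where
  "sign_mat n = (\<lambda>(X, Y, Z). mat 3 n (\<lambda>(r, c). if c \<in> [X, Y, Z] ! r then 1 else - 1))"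

lemma less_3_iff: "r < 3 \<longleftrightarrow> r = 0 \<or> r = 1 \<or> r = (2::nat)"
  by auto

lemma sum_less_3: "(\<Sum>r<3. f r) = f 0 + f 1 + f (2::nat)" for f :: "nat \<Rightarrow> int"
  by (simp add: eval_nat_numeral)

lemma sign_mat_mem:
  assumes "X \<subseteq> {..<n}" "Y \<subseteq> {..<n}" "Z \<subseteq> {..<n}"
  shows "sign_mat n (X, Y, Z) \<in> A 3 n \<longleftrightarrow> (X, Y, Z) \<in> plus_sets n"
proof -
  let ?M = "sign_mat n (X, Y, Z)"
  have entry: "?M $$ (r, c) = (if c \<in> [X, Y, Z] ! r then 1 else - 1)" if "r < 3" "c < n" for r c
    using that by (simp add: sign_mat_def)
  have row: "(\<Sum>c<n. ?M $$ (r, c)) = 2 * int (card ([X, Y, Z] ! r)) - int n" if "r < 3" for r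
  proof -
    have "[X, Y, Z] ! r \<subseteq> {..<n}" using that assms by (auto simp: less_3_iff)
    then show ?thesis using entry that by (simp flip: sum_signs)
  qed
  have rows: "(\<forall>r<3. \<bar>\<Sum>c<n. ?M $$ (r, c)\<bar> \<le> 1) \<longleftrightarrow>
      balanced n (card X) \<and> balanced n (card Y) \<and> balanced n (card Z)"
    unfolding less_3_iff using row[of 0] row[of 1] row[of 2] by (auto simp: balanced_def)
  have col: "\<bar>\<Sum>r<3. ?M $$ (r, c)\<bar> \<le> 1 \<longleftrightarrow> c \<notin> X \<inter> Y \<inter> Z \<and> c \<in> X \<union> Y \<union> Z" if "c < n" for c
    using that by (simp add: sum_less_3 entry)
  have cols: "(\<forall>c<n. \<bar>\<Sum>r<3. ?M $$ (r, c)\<bar> \<le> 1) \<longleftrightarrow> X \<inter> Y \<inter> Z = {} \<and> X \<union> Y \<union> Z = {..<n}"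
    using assms by (auto simp: col)
  have "?M \<in> carrier_mat 3 n" "\<forall>r<3. \<forall>c<n. ?M $$ (r, c) \<in> {1, - 1}"
    by (auto simp: entry) (simp add: sign_mat_def)
  then show ?thesis by (auto simp: A_def plus_sets_def rows cols)
qed

text \<open>The inverse reads off where each row is 1; entries different from 1 can only be -1, so
  these positions determine the matrix.\<close>

lemma bij_betw_sign_mat: "bij_betw (sign_mat n) (plus_sets n) (A 3 n)"
proof (rule bij_betw_imageI)
  have sub: "X \<subseteq> {..<n}" "Y \<subseteq> {..<n}" "Z \<subseteq> {..<n}" if "(X, Y, Z) \<in> plus_sets n" for X Y Z
    using that by (auto simp: plus_sets_def)
  define row where "row M r = {c. c < n \<and> M $$ (r, c) = 1}" for M :: "int mat" and r :: nat
  have row: "row (sign_mat n (X, Y, Z)) 0 = X" "row (sign_mat n (X, Y, Z)) 1 = Y"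
    "row (sign_mat n (X, Y, Z)) 2 = Z" if "(X, Y, Z) \<in> plus_sets n" for X Y Z
    using sub[OF that] by (auto simp: sign_mat_def row_def split: if_splits)
  show "inj_on (sign_mat n) (plus_sets n)"
  proof (rule inj_onI)
    fix p q assume pq: "p \<in> plus_sets n" "q \<in> plus_sets n" "sign_mat n p = sign_mat n q"
    obtain X Y Z X' Y' Z' where "p = (X, Y, Z)" "q = (X', Y', Z')"
      by (metis prod_cases3)
    then show "p = q" using row[of X Y Z] row[of X' Y' Z'] pq by simp
  qed
  show "sign_mat n ` plus_sets n = A 3 n"
  proof (intro subset_antisym image_subsetI subsetI)
    fix p assume p: "p \<in> plus_sets n"
    obtain X Y Z where "p = (X, Y, Z)" by (rule prod_cases3)
    with p show "sign_mat n p \<in> A 3 n"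
      using sign_mat_mem[OF sub, THEN iffD2] by (simp only:)
  next
    fix M assume M: "M \<in> A 3 n"
    let ?p = "(row M 0, row M 1, row M 2)"
    have dim: "M \<in> carrier_mat 3 n"
      using M by (simp add: A_def)
    have entry: "M $$ (r, c) = - 1" if "r < 3" "c < n" "M $$ (r, c) \<noteq> 1" for r c
      using M that by (auto simp: A_def)
    have "sign_mat n ?p = M"
      using dim entry[of 0] entry[of 1] entry[of 2]
      by (intro eq_matI) (auto simp: sign_mat_def row_def less_3_iff)
    moreover have "row M r \<subseteq> {..<n}" for r
      by (auto simp: row_def)
    ultimately have "?p \<in> plus_sets n"
      using M sign_mat_mem[THEN iffD1] by (simp only:)
    then show "M \<in> sign_mat n ` plus_sets n"
      using \<open>sign_mat n ?p = M\<close> by (rule image_eqI[rotated, OF _ sym])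
  qed
qed

section \<open>Parametrization by the columns where rows two and three differ\<close>

text \<open>Where rows two and three agree, they are opposite to row one, hence both 1 exactly on
  the n - card X - card J columns outside \<open>X\<close> and \<open>J\<close>. Row two has further
  entries 1 on \<open>T\<close>, row three on the rest of \<open>I \<union> J\<close>. The nested
  \<open>SIGMA\<close> form lets the cardinality be computed one layer at a time.\<close>

definition mixed_sets :: "nat \<Rightarrow> (nat set \<times> nat set \<times> nat set \<times> nat set) set" where
  "mixed_sets n = (SIGMA X:Pow {..<n}. SIGMA I:Pow X. SIGMA J:Pow ({..<n} - X).
     {T \<in> Pow (I \<union> J). balanced n (card X) \<and>
        balanced n (card T + (n - card X - card J)) \<and>
        balanced n (card I + card J - card T + (n - card X - card J))})"

lemma bij_betw_mixed_sets:
  "bij_betw (\<lambda>(X, I, J, T). (X, T \<union> ({..<n} - X - J), (I \<union> J - T) \<union> ({..<n} - X - J)))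
     (mixed_sets n) (plus_sets n)"
proof -
  let ?f = "\<lambda>(X, I, J, T). (X, T \<union> ({..<n} - X - J), (I \<union> J - T) \<union> ({..<n} - X - J))"
  \<comment> \<open>Inside \<open>X\<close> a column is never in both \<open>Y\<close> and
    \<open>Z\<close>, so the two rows differ iff it lies in at least one of them. Outside
    \<open>X\<close> it lies in at least one, so they differ iff it is not in both.\<close>
  let ?g = "\<lambda>(X, Y, Z). (X, X \<inter> (Y \<union> Z), {..<n} - X - (Y \<inter> Z), Y - Z)"
  have card: "card (T \<union> ({..<n} - X - J)) = card T + (n - card X - card J)"
       "card ((I \<union> J - T) \<union> ({..<n} - X - J)) = card I + card J - card T + (n - card X - card J)"
    if "X \<subseteq> {..<n}" "I \<subseteq> X" "J \<subseteq> {..<n} - X" "T \<subseteq> I \<union> J" for X I J T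
  proof -
    have fin: "finite X" "finite I" "finite J" "finite T"
      using that by (meson finite_Diff finite_Un finite_lessThan finite_subset)+
    have r: "card ({..<n} - X - J) = n - card X - card J"
      using that fin by (simp add: card_Diff_subset)
    have "card (T \<union> ({..<n} - X - J)) = card T + card ({..<n} - X - J)"
      using that fin by (intro card_Un_disjoint) auto
    then show "card (T \<union> ({..<n} - X - J)) = card T + (n - card X - card J)"
      using r by simp
    have "card ((I \<union> J - T) \<union> ({..<n} - X - J)) = card (I \<union> J - T) + card ({..<n} - X - J)"
      using that fin by (intro card_Un_disjoint) auto
    moreover have "card (I \<union> J - T) = card I + card J - card T"
    proof -
      have "card (I \<union> J) = card I + card J"
        using that fin by (intro card_Un_disjoint) auto
      then show ?thesis using that fin by (simp add: card_Diff_subset)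
    qed
    ultimately show "card ((I \<union> J - T) \<union> ({..<n} - X - J)) =
        card I + card J - card T + (n - card X - card J)"
      using r by simp
  qed
  have f: "?f (X, I, J, T) \<in> plus_sets n" "?g (?f (X, I, J, T)) = (X, I, J, T)"
    if "(X, I, J, T) \<in> mixed_sets n" for X I J T
  proof -
    have *: "X \<subseteq> {..<n}" "I \<subseteq> X" "J \<subseteq> {..<n} - X" "T \<subseteq> I \<union> J"
      using that by (auto simp: mixed_sets_def)
    show "?f (X, I, J, T) \<in> plus_sets n"
      using that * card[OF *] unfolding plus_sets_def mixed_sets_def by auto
    show "?g (?f (X, I, J, T)) = (X, I, J, T)"
      using * by auto
  qed
  have g: "?g (X, Y, Z) \<in> mixed_sets n" "?f (?g (X, Y, Z)) = (X, Y, Z)"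
    if "(X, Y, Z) \<in> plus_sets n" for X Y Z
  proof -
    let ?I = "X \<inter> (Y \<union> Z)" and ?J = "{..<n} - X - (Y \<inter> Z)" and ?T = "Y - Z"
    have *: "X \<inter> Y \<inter> Z = {}" "X \<union> Y \<union> Z = {..<n}"
      using that by (auto simp: plus_sets_def)
    have **: "X \<subseteq> {..<n}" "?I \<subseteq> X" "?J \<subseteq> {..<n} - X" "?T \<subseteq> ?I \<union> ?J"
      using * by auto
    have Y: "?T \<union> ({..<n} - X - ?J) = Y" and Z: "(?I \<union> ?J - ?T) \<union> ({..<n} - X - ?J) = Z"
      using * by blast+
    show "?f (?g (X, Y, Z)) = (X, Y, Z)"
      using Y Z by simp
    have "balanced n (card X)" "balanced n (card Y)" "balanced n (card Z)"
      using that by (auto simp: plus_sets_def)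
    then show "?g (X, Y, Z) \<in> mixed_sets n"
      using card[OF **] ** unfolding Y Z mixed_sets_def by simp
  qed
  show ?thesis
  proof (rule bij_betw_byWitness[where f' = ?g])
    show "\<forall>p\<in>mixed_sets n. ?g (?f p) = p"
    proof
      fix p assume p: "p \<in> mixed_sets n"
      obtain X I J T where "p = (X, I, J, T)" by (rule prod_cases4)
      then show "?g (?f p) = p" using f(2)[of X I J T] p by (simp only:)
    qed
    show "\<forall>p\<in>plus_sets n. ?f (?g p) = p"
    proof
      fix p assume p: "p \<in> plus_sets n"
      obtain X Y Z where "p = (X, Y, Z)" by (rule prod_cases3)
      then show "?f (?g p) = p" using g(2)[of X Y Z] p by (simp only:)
    qed
    show "?f ` mixed_sets n \<subseteq> plus_sets n"
    proof (rule image_subsetI)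
      fix p assume p: "p \<in> mixed_sets n"
      obtain X I J T where "p = (X, I, J, T)" by (rule prod_cases4)
      then show "?f p \<in> plus_sets n" using f(1)[of X I J T] p by (simp only:)
    qed
    show "?g ` plus_sets n \<subseteq> mixed_sets n"
    proof (rule image_subsetI)
      fix p assume p: "p \<in> plus_sets n"
      obtain X Y Z where "p = (X, Y, Z)" by (rule prod_cases3)
      then show "?g p \<in> mixed_sets n" using g(1)[of X Y Z] p by (simp only:)
    qed
  qed
qed

section \<open>Counting by cardinalities\<close>

lemma sum_Pow_card:
  fixes f :: "nat \<Rightarrow> nat"
  assumes "finite S"
  shows "(\<Sum>X\<in>Pow S. f (card X)) = (\<Sum>x\<le>card S. (card S choose x) * f x)"
proof -
  have "(\<Sum>X\<in>Pow S. f (card X)) = (\<Sum>x\<le>card S. \<Sum>X\<in>{X \<in> Pow S. card X = x}. f (card X))"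
    using assms by (intro sum.group[symmetric]) (auto intro: card_mono)
  also have "\<dots> = (\<Sum>x\<le>card S. (card S choose x) * f x)"
    using assms by (intro sum.cong) (auto simp: n_subsets Pow_def)
  finally show ?thesis .
qed

lemma card_filter_Pow:
  assumes "finite S"
  shows "card {T \<in> Pow S. P (card T)} = (\<Sum>t\<le>card S. (card S choose t) * of_bool (P t))"
proof -
  have "card {T \<in> Pow S. P (card T)} = (\<Sum>T\<in>Pow S. of_bool (P (card T)))"
    using assms by (simp add: Int_def)
  then show ?thesis using sum_Pow_card[OF assms, of "\<lambda>t. of_bool (P t)"] by simp
qed

text \<open>The constraints see only the four cardinalities, so each choice of a subset contributes
  a binomial weight. The condition on \<open>x\<close> stays in the innermost indicator, so the
  summand for any unbalanced \<open>x\<close> vanishes.\<close>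

lemma alpha_3_eq_sum:
  "alpha 3 n = (\<Sum>x\<le>n. (n choose x) * (\<Sum>i\<le>x. (x choose i) * (\<Sum>j\<le>n - x. (n - x choose j) *
     (\<Sum>t\<le>i + j. (i + j choose t) *
        of_bool (balanced n x \<and> balanced n (t + (n - x - j)) \<and>
          balanced n (i + j - t + (n - x - j)))))))"
proof -
  let ?P = "\<lambda>x i j t. balanced n x \<and> balanced n (t + (n - x - j)) \<and>
          balanced n (i + j - t + (n - x - j))"
  let ?t = "\<lambda>x i j. \<Sum>t\<le>i + j. (i + j choose t) * of_bool (?P x i j t)"
  have inner: "card {T \<in> Pow (I \<union> J). ?P (card X) (card I) (card J) (card T)} =
      ?t (card X) (card I) (card J)"
    if "X \<subseteq> {..<n}" "I \<subseteq> X" "J \<subseteq> {..<n} - X" for X I J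
  proof -
    have fin: "finite I" "finite J"
      using that by (meson finite_Diff finite_lessThan finite_subset)+
    have "card (I \<union> J) = card I + card J"
      using that fin by (intro card_Un_disjoint) auto
    then show ?thesis
      using card_filter_Pow[of "I \<union> J" "?P (card X) (card I) (card J)"] fin by simp
  qed
  have "alpha 3 n = card (mixed_sets n)"
    unfolding alpha_def
    using bij_betw_same_card[OF bij_betw_sign_mat] bij_betw_same_card[OF bij_betw_mixed_sets]
    by metis
  \<comment> \<open>The layers of the \<open>SIGMA\<close> are peeled off by
    \<open>card_SigmaI\<close>, which asks for finiteness of the fibres at each level.\<close>
  also have "\<dots> = (\<Sum>X\<in>Pow {..<n}. \<Sum>I\<in>Pow X. \<Sum>J\<in>Pow ({..<n} - X).
      ?t (card X) (card I) (card J))"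
  proof -
    let ?F = "\<lambda>X I J. {T \<in> Pow (I \<union> J). ?P (card X) (card I) (card J) (card T)}"
    have finF: "finite (?F X I J)" if "X \<subseteq> {..<n}" "I \<subseteq> X" "J \<subseteq> {..<n} - X" for X I J
    proof -
      have "I \<union> J \<subseteq> {..<n}" using that by auto
      then have "finite (I \<union> J)" by (rule finite_subset) simp
      then have "finite (Pow (I \<union> J))" by (rule finite_Pow_iff[THEN iffD2])
      then show ?thesis by (rule rev_finite_subset) blast
    qed
    have finX: "finite (Pow X)" if "X \<subseteq> {..<n}" for X
      using that by (simp add: finite_subset)
    have eq: "card (SIGMA I:Pow X. SIGMA J:Pow ({..<n} - X). ?F X I J) =
        (\<Sum>I\<in>Pow X. \<Sum>J\<in>Pow ({..<n} - X). ?t (card X) (card I) (card J))"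
      if X: "X \<subseteq> {..<n}" for X
    proof -
      have "card (SIGMA J:Pow ({..<n} - X). ?F X I J) =
          (\<Sum>J\<in>Pow ({..<n} - X). ?t (card X) (card I) (card J))" if "I \<subseteq> X" for I
      proof (subst card_SigmaI)
        show "\<forall>J\<in>Pow ({..<n} - X). finite (?F X I J)"
          using finF[OF X that] by (meson PowD)
        show "(\<Sum>J\<in>Pow ({..<n} - X). card (?F X I J)) =
            (\<Sum>J\<in>Pow ({..<n} - X). ?t (card X) (card I) (card J))"
          using inner[OF X that] by (meson PowD sum.cong)
      qed simp
      moreover have "\<forall>I\<in>Pow X. finite (SIGMA J:Pow ({..<n} - X). ?F X I J)"
      proof (intro ballI finite_SigmaI)
        show "finite (?F X I J)" if "I \<in> Pow X" "J \<in> Pow ({..<n} - X)" for I J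
          using finF[OF X, of I J] that by (meson PowD)
      qed simp
      ultimately show ?thesis
        using finX[OF X] by (subst card_SigmaI) (auto intro: sum.cong)
    qed
    have fin: "\<forall>X\<in>Pow {..<n}. finite (SIGMA I:Pow X. SIGMA J:Pow ({..<n} - X). ?F X I J)"
    proof (intro ballI finite_SigmaI)
      show "finite (?F X I J)" if "X \<in> Pow {..<n}" "I \<in> Pow X" "J \<in> Pow ({..<n} - X)" for X I J
        using finF[of X I J] that by (meson PowD)
      show "finite (Pow X)" if "X \<in> Pow {..<n}" for X
        using finX that by blast
    qed simp
    have "card (mixed_sets n) =
        (\<Sum>X\<in>Pow {..<n}. card (SIGMA I:Pow X. SIGMA J:Pow ({..<n} - X). ?F X I J))"
      unfolding mixed_sets_def using fin by (intro card_SigmaI) simp_all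
    also have "\<dots> = (\<Sum>X\<in>Pow {..<n}. \<Sum>I\<in>Pow X. \<Sum>J\<in>Pow ({..<n} - X).
        ?t (card X) (card I) (card J))"
      by (rule sum.cong[OF refl], rule eq) blast
    finally show ?thesis .
  qed
  \<comment> \<open>For fixed \<open>X\<close>, the sum over \<open>J\<close> is replaced first, for
    arbitrary \<open>i\<close>; what remains depends on \<open>I\<close> only through its
    size.\<close>
  also have "\<dots> = (\<Sum>X\<in>Pow {..<n}. \<Sum>i\<le>card X. (card X choose i) *
      (\<Sum>j\<le>n - card X. (n - card X choose j) * ?t (card X) i j))"
  proof (rule sum.cong[OF refl])
    fix X assume "X \<in> Pow {..<n}"
    then have X: "finite X" "card ({..<n} - X) = n - card X"
      by (auto intro: finite_subset simp: card_Diff_subset finite_subset)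
    show "(\<Sum>I\<in>Pow X. \<Sum>J\<in>Pow ({..<n} - X). ?t (card X) (card I) (card J)) =
        (\<Sum>i\<le>card X. (card X choose i) *
          (\<Sum>j\<le>n - card X. (n - card X choose j) * ?t (card X) i j))"
    proof -
      have "(\<Sum>J\<in>Pow ({..<n} - X). ?t (card X) i (card J)) =
          (\<Sum>j\<le>n - card X. (n - card X choose j) * ?t (card X) i j)" for i
        using sum_Pow_card[of "{..<n} - X" "?t (card X) i"] unfolding X(2)
        by (simp only: finite_Diff finite_lessThan)
      then show ?thesis
        using sum_Pow_card[OF X(1), of "\<lambda>i. (\<Sum>j\<le>n - card X. (n - card X choose j) * ?t (card X) i j)"]
        by (simp only:)
    qed
  qed
  also have "\<dots> = (\<Sum>x\<le>n. (n choose x) * (\<Sum>i\<le>x. (x choose i) *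
      (\<Sum>j\<le>n - x. (n - x choose j) * ?t x i j)))"
    using sum_Pow_card[of "{..<n}" "\<lambda>x. \<Sum>i\<le>x. (x choose i) *
      (\<Sum>j\<le>n - x. (n - x choose j) * ?t x i j)"] by simp
  finally show ?thesis .
qed

section \<open>Binomial identities\<close>

text \<open>Split (2k)! into k! k! and a central binomial coefficient, then split each k! at
  \<open>i\<close>. The factorials that remain are exactly the denominator, so \<open>div\<close> is
  exact.\<close>

lemma multinomial_eq:
  assumes "i \<le> k"
  shows "multinomial (2 * k) (k - i) (k - i) i i = (2 * k choose k) * (k choose i)\<^sup>2"
proof -
  have k: "fact k = (fact i * fact (k - i) * (k choose i) :: nat)"
    using binomial_fact_lemma[OF assms] by simp
  have "fact (2 * k) = (fact k * fact k * (2 * k choose k) :: nat)"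
    using binomial_fact_lemma[of k "2 * k"] by (simp add: mult_2)
  also have "\<dots> = (2 * k choose k) * (k choose i)\<^sup>2 * (fact (k - i) * fact (k - i) * fact i * fact i)"
    by (subst (1 2) k) (simp add: power2_eq_square mult_ac)
  finally show ?thesis
    unfolding multinomial_def by simp
qed

text \<open>Both sides equal \<open>n * (n - 1 choose m)\<close>.\<close>

lemma choose_Suc_mult: "Suc m * (n choose Suc m) = (n - m) * (n choose m)"
  using binomial_absorption[of m n] binomial_absorb_comp[of n m] by simp

text \<open>Absorption turns both sides, multiplied by \<open>m + 2\<close>, into the same product.\<close>

lemma choose_shift:
  "(k choose Suc m) * (Suc k choose Suc m) * (2 * m + 2 choose (m + 2)) =
   (k choose m) * (Suc k choose (m + 2)) * (2 * m + 2 choose Suc m)"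
proof -
  let ?B = "2 * m + 2 choose Suc m" and ?C = "Suc k choose Suc m"
  have B: "(m + 2) * (2 * m + 2 choose (m + 2)) = Suc m * ?B"
    using choose_Suc_mult[of "Suc m" "2 * m + 2"] by simp
  have C: "(m + 2) * (Suc k choose (m + 2)) = (k - m) * ?C"
    using choose_Suc_mult[of "Suc m" "Suc k"] by simp
  have "(m + 2) * ((k choose Suc m) * ?C * (2 * m + 2 choose (m + 2))) =
      (k choose Suc m) * ?C * ((m + 2) * (2 * m + 2 choose (m + 2)))"
    by (simp only: mult_ac)
  also have "\<dots> = Suc m * (k choose Suc m) * ?C * ?B"
    unfolding B by (simp only: mult_ac)
  also have "\<dots> = (k choose m) * ((k - m) * ?C) * ?B"
    unfolding choose_Suc_mult by (simp only: mult_ac)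
  also have "\<dots> = (m + 2) * ((k choose m) * (Suc k choose (m + 2)) * ?B)"
    unfolding C[symmetric] by (simp only: mult_ac)
  finally show ?thesis by (simp del: binomial_Suc_Suc mult_Suc)
qed

text \<open>Put i = j + 1 on the right and apply \<open>choose_shift\<close> termwise. The term i =
  0 vanishes because of \<open>0 choose 1\<close>, and the added term i = k + 1 because of
  \<open>k choose (k + 1)\<close>.\<close>

lemma sum_choose_shift:
  "(\<Sum>j\<le>k. (k choose j) * (k + 1 choose (j + 2)) * (2 * j + 2 choose (j + 1))) =
   (\<Sum>i\<le>k. (k choose i) * (k + 1 choose i) * (2 * i choose (i + 1)))"
proof -
  have "(\<Sum>i\<le>k. (k choose i) * (k + 1 choose i) * (2 * i choose (i + 1))) =
      (\<Sum>i\<le>Suc k. (k choose i) * (k + 1 choose i) * (2 * i choose (i + 1)))"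
    by simp
  also have "\<dots> = (\<Sum>m\<le>k. (k choose Suc m) * (Suc k choose Suc m) * (2 * m + 2 choose (m + 2)))"
    by (subst sum.atMost_Suc_shift) simp
  finally show ?thesis
    unfolding choose_shift by (simp only: Suc_eq_plus1)
qed

text \<open>Passes from the expression that the count yields to the stated closed form. The shift
  turns the third summand into a multiple of \<open>k + 1 choose i\<close>, where Pascal's rule
  merges it with the first.\<close>

lemma sum_odd:
  "(\<Sum>j\<le>k. (k choose j) * ((k + 1 choose j) * (2 * j choose j) +
      2 * (k + 1 choose (j + 1)) * (2 * j + 1 choose j) +
      (k + 1 choose (j + 2)) * (2 * j + 2 choose (j + 1)))) =
   (\<Sum>i=0..k. (k choose i) * ((2 * i + 1 choose (i + 1)) * (k + 1 choose i) +
      2 * (k + 1 choose (i + 1)) * (2 * i + 1 choose i)))" (is "?L = ?R")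
proof -
  let ?m = "\<lambda>i. (k choose i) * (2 * (k + 1 choose (i + 1)) * (2 * i + 1 choose i))"
  have "?L = (\<Sum>j\<le>k. (k choose j) * (k + 1 choose j) * (2 * j choose j)) + (\<Sum>j\<le>k. ?m j) +
      (\<Sum>j\<le>k. (k choose j) * (k + 1 choose (j + 2)) * (2 * j + 2 choose (j + 1)))"
    by (simp only: distrib_left sum.distrib mult.assoc)
  also have "\<dots> = (\<Sum>i\<le>k. (k choose i) * (k + 1 choose i) * ((2 * i choose i) + (2 * i choose (i + 1)))) +
      (\<Sum>j\<le>k. ?m j)"
    unfolding sum_choose_shift by (simp only: distrib_left sum.distrib)
  also have "\<dots> = ?R"
  proof -
    have "(2 * i choose i) + (2 * i choose (i + 1)) = (2 * i + 1 choose (i + 1))" for i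
      by simp
    then show ?thesis
      by (simp only: atLeast0AtMost distrib_left sum.distrib mult_ac)
  qed
  finally show ?thesis .
qed

section \<open>Evaluating the inner sums\<close>

text \<open>Collapses a sum whose index is pinned to \<open>a\<close>; for \<open>a > m\<close> both
  sides are 0. The weight \<open>f\<close> and the residual condition \<open>Q\<close> allow
  repeated use: first for \<open>t\<close>, then for the next index with a binomial coefficient as
  weight.\<close>

lemma sum_choose_delta:
  "(\<Sum>t\<le>m. (m choose t) * (f t * of_bool (t = a \<and> Q))) = (m choose a) * (f a * of_bool Q)"
  for f :: "nat \<Rightarrow> nat"
proof -
  have "(\<Sum>t\<le>m. (m choose t) * (f t * of_bool (t = a \<and> Q))) =
      (\<Sum>t\<le>m. if t = a then (m choose t) * (f t * of_bool Q) else 0)"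
    by (rule sum.cong) auto
  then show ?thesis by (simp add: binomial_eq_0)
qed

text \<open>When row one has \<open>k\<close> entries 1, row two forces t = j and row three then
  forces i = j.\<close>

lemma sum_choose_even:
  "(\<Sum>i\<le>k. (k choose i) * (\<Sum>j\<le>k. (k choose j) * (\<Sum>t\<le>i + j. (i + j choose t) *
     of_bool (balanced (2 * k) (t + (k - j)) \<and> balanced (2 * k) (i + j - t + (k - j)))))) =
   (\<Sum>i=0..k. (k choose i)\<^sup>2 * (2 * i choose i))"
proof -
  \<comment> \<open>The bound \<open>j \<le> k\<close> makes \<open>k - j\<close> exact. The
    conjunct \<open>True\<close> leaves the result in the shape of \<open>sum_choose_delta\<close>
    for the sum over \<open>j\<close>.\<close>
  have t: "(\<Sum>t\<le>i + j. (i + j choose t) *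
     of_bool (balanced (2 * k) (t + (k - j)) \<and> balanced (2 * k) (i + j - t + (k - j)))) =
     (i + j choose j) * of_bool (j = i \<and> True)" if "j \<le> k" for i j
  proof -
    have "(\<Sum>t\<le>i + j. (i + j choose t) *
       of_bool (balanced (2 * k) (t + (k - j)) \<and> balanced (2 * k) (i + j - t + (k - j)))) =
       (\<Sum>t\<le>i + j. (i + j choose t) * (1 * of_bool (t = j \<and> j = i)))"
    proof (intro sum.cong refl)
      fix t assume "t \<in> {..i + j}"
      then have "balanced (2 * k) (t + (k - j)) \<and> balanced (2 * k) (i + j - t + (k - j)) \<longleftrightarrow>
          t = j \<and> j = i"
        using that by (auto simp: balanced_even)
      then show "(i + j choose t) * of_bool (balanced (2 * k) (t + (k - j)) \<and>
          balanced (2 * k) (i + j - t + (k - j))) = (i + j choose t) * (1 * of_bool (t = j \<and> j = i))"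
        by (simp only: mult_1)
    qed
    then show ?thesis by (simp only: sum_choose_delta) simp
  qed
  have "(\<Sum>j\<le>k. (k choose j) * (\<Sum>t\<le>i + j. (i + j choose t) *
     of_bool (balanced (2 * k) (t + (k - j)) \<and> balanced (2 * k) (i + j - t + (k - j))))) =
     (k choose i) * (2 * i choose i)" for i
    using t sum_choose_delta[of k "\<lambda>j. i + j choose j" i True] by (simp add: mult_2)
  then show ?thesis
    by (simp add: power2_eq_square atLeast0AtMost mult.assoc)
qed

text \<open>Here \<open>p\<close> and \<open>q\<close> are the numbers of mixed columns on the sides
  of size \<open>k\<close> and \<open>k + 1\<close>. Four cases (t, q) survive: (p, p), (p, p + 1),
  (p + 1, p + 1), (p + 1, p + 2). The middle two contribute equally by symmetry of the binomial
  coefficients, hence the factor 2.\<close>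

lemma sum_choose_odd:
  "(\<Sum>p\<le>k. (k choose p) * (\<Sum>q\<le>k + 1. (k + 1 choose q) * (\<Sum>t\<le>p + q. (p + q choose t) *
     of_bool ((t = p \<or> t = p + 1) \<and> (q = t \<or> q = t + 1))))) =
   (\<Sum>j\<le>k. (k choose j) * ((k + 1 choose j) * (2 * j choose j) +
      2 * (k + 1 choose (j + 1)) * (2 * j + 1 choose j) +
      (k + 1 choose (j + 2)) * (2 * j + 2 choose (j + 1))))"
proof (intro sum.cong refl arg_cong2[where f = "(*)"])
  fix p
  have t: "(\<Sum>t\<le>p + q. (p + q choose t) * of_bool ((t = p \<or> t = p + 1) \<and> (q = t \<or> q = t + 1))) =
    (p + q choose p) * of_bool (q = p \<and> True) + (p + q choose p) * of_bool (q = p + 1 \<and> True) +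
    (p + q choose (p + 1)) * of_bool (q = p + 1 \<and> True) +
    (p + q choose (p + 1)) * of_bool (q = p + 2 \<and> True)" for q
  proof -
    \<comment> \<open>The four cases exclude each other, so the indicator is the sum of theirs; the
      factor 1 is the weight \<open>f\<close> of \<open>sum_choose_delta\<close>.\<close>
    have "(\<Sum>t\<le>p + q. (p + q choose t) * of_bool ((t = p \<or> t = p + 1) \<and> (q = t \<or> q = t + 1))) =
      (\<Sum>t\<le>p + q. (p + q choose t) * (1 * of_bool (t = p \<and> q = p)) +
         (p + q choose t) * (1 * of_bool (t = p \<and> q = p + 1)) +
         (p + q choose t) * (1 * of_bool (t = p + 1 \<and> q = p + 1)) +
         (p + q choose t) * (1 * of_bool (t = p + 1 \<and> q = p + 2)))"
      by (rule sum.cong) auto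
    then show ?thesis by (simp only: sum.distrib sum_choose_delta) simp
  qed
  have "(\<Sum>q\<le>k + 1. (k + 1 choose q) * (\<Sum>t\<le>p + q. (p + q choose t) *
      of_bool ((t = p \<or> t = p + 1) \<and> (q = t \<or> q = t + 1)))) =
    (k + 1 choose p) * (p + p choose p) + (k + 1 choose (p + 1)) * (p + (p + 1) choose p) +
    (k + 1 choose (p + 1)) * (p + (p + 1) choose (p + 1)) +
    (k + 1 choose (p + 2)) * (p + (p + 2) choose (p + 1))"
    unfolding t by (simp only: distrib_left sum.distrib sum_choose_delta of_bool_eq mult_1_right)
  moreover have "(2 * p + 1 choose (p + 1)) = (2 * p + 1 choose p)"
    using binomial_symmetric[of p "2 * p + 1"] by simp
  moreover have e: "p + p = 2 * p" "p + (p + 1) = 2 * p + 1" "p + (p + 2) = 2 * p + 2"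
    "x * y + x * y = 2 * (x * y)" "(u + v) + v + w = u + 2 * v + w" for x y u v w :: nat
    by simp_all
  ultimately show "(\<Sum>q\<le>k + 1. (k + 1 choose q) * (\<Sum>t\<le>p + q. (p + q choose t) *
      of_bool ((t = p \<or> t = p + 1) \<and> (q = t \<or> q = t + 1)))) =
    (k + 1 choose p) * (2 * p choose p) + 2 * (k + 1 choose (p + 1)) * (2 * p + 1 choose p) +
      (k + 1 choose (p + 2)) * (2 * p + 2 choose (p + 1))"
    by (simp only: e mult.assoc)
qed

section \<open>The two parities\<close>

lemma sum_choose_split_odd:
  assumes "\<And>x. \<not> balanced (2 * k + 1) x \<Longrightarrow> G x = 0"
  shows "(\<Sum>x\<le>2 * k + 1. (2 * k + 1 choose x) * G x) = (2 * k + 1 choose k) * (G k + G (k + 1))"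
proof -
  have "(\<Sum>x\<le>2 * k + 1. (2 * k + 1 choose x) * G x) = (\<Sum>x\<in>{k, k + 1}. (2 * k + 1 choose x) * G x)"
    using assms[unfolded balanced_odd] by (intro sum.mono_neutral_right) auto
  moreover have "(2 * k + 1 choose (k + 1)) = (2 * k + 1 choose k)"
    using binomial_symmetric[of k "2 * k + 1"] by simp
  ultimately show ?thesis by (simp add: distrib_left del: binomial_Suc_Suc)
qed

lemma alpha_3_even: "alpha 3 (2 * k) = (2 * k choose k) * (\<Sum>i=0..k. (k choose i)\<^sup>2 * (2 * i choose i))"
proof -
  define G where "G x = (\<Sum>i\<le>x. (x choose i) * (\<Sum>j\<le>2 * k - x. (2 * k - x choose j) *
     (\<Sum>t\<le>i + j. (i + j choose t) *
        of_bool (balanced (2 * k) x \<and> balanced (2 * k) (t + (2 * k - x - j)) \<and>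
          balanced (2 * k) (i + j - t + (2 * k - x - j))))))" for x
  have "alpha 3 (2 * k) = (\<Sum>x\<le>2 * k. (2 * k choose x) * G x)"
    unfolding alpha_3_eq_sum G_def ..
  \<comment> \<open>For other \<open>x\<close> the condition on row one makes every indicator in
    \<open>G x\<close> zero.\<close>
  also have "\<dots> = (\<Sum>x\<in>{k}. (2 * k choose x) * G x)"
    by (intro sum.mono_neutral_right) (auto simp: balanced_even G_def)
  also have "\<dots> = (2 * k choose k) * G k" by simp
  also have "G k = (\<Sum>i=0..k. (k choose i)\<^sup>2 * (2 * i choose i))"
  proof -
    have "2 * k - k = k" "balanced (2 * k) k = True" by (simp_all add: balanced_even)
    then show ?thesis unfolding G_def by (simp only: sum_choose_even simp_thms)
  qed
  finally show ?thesis .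
qed

text \<open>Row one has \<open>k\<close> or \<open>k + 1\<close> entries 1; both sizes give the same
  inner sum, hence the leading factor 2.\<close>

lemma alpha_3_odd:
  "alpha 3 (2 * k + 1) = 2 * (2 * k + 1 choose k) *
     (\<Sum>i=0..k. (k choose i) * ((2 * i + 1 choose (i + 1)) * (k + 1 choose i) +
        2 * (k + 1 choose (i + 1)) * (2 * i + 1 choose i)))" (is "_ = _ * ?S")
proof -
  let ?n = "2 * k + 1"
  let ?T = "\<lambda>p q. \<Sum>t\<le>p + q. (p + q choose t) *
     of_bool ((t = p \<or> t = p + 1) \<and> (q = t \<or> q = t + 1))"
  define G where "G x = (\<Sum>i\<le>x. (x choose i) * (\<Sum>j\<le>?n - x. (?n - x choose j) *
     (\<Sum>t\<le>i + j. (i + j choose t) *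
        of_bool (balanced ?n x \<and> balanced ?n (t + (?n - x - j)) \<and>
          balanced ?n (i + j - t + (?n - x - j))))))" for x
  have S: "(\<Sum>p\<le>k. (k choose p) * (\<Sum>q\<le>k + 1. (k + 1 choose q) * ?T p q)) = ?S"
    unfolding sum_choose_odd sum_odd ..
  have "alpha 3 ?n = (\<Sum>x\<le>?n. (?n choose x) * G x)"
    unfolding alpha_3_eq_sum G_def ..
  also have "\<dots> = (?n choose k) * (G k + G (k + 1))"
    by (rule sum_choose_split_odd) (simp add: G_def)
  also have "G k = ?S"
  proof -
    \<comment> \<open>Row two gives q = t or q = t + 1, row three t = p or t = p + 1, with p = i and
      q = j. The range of \<open>j\<close> keeps \<open>k + 1 - j\<close> exact.\<close>
    have "(\<Sum>t\<le>i + j. (i + j choose t) * of_bool (balanced ?n k \<and>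
        balanced ?n (t + (k + 1 - j)) \<and> balanced ?n (i + j - t + (k + 1 - j)))) = ?T i j"
      if "j \<in> {..k + 1}" for i j
      unfolding balanced_odd using that
      by (intro sum.cong refl arg_cong2[where f = "(*)"] arg_cong[where f = of_bool]) auto
    moreover have "?n - k = k + 1" by simp
    ultimately have "G k = (\<Sum>p\<le>k. (k choose p) * (\<Sum>q\<le>k + 1. (k + 1 choose q) * ?T p q))"
      unfolding G_def by (simp only: cong: sum.cong)
    then show ?thesis using S by simp
  qed
  also have "G (k + 1) = ?S"
  proof -
    \<comment> \<open>Now \<open>X\<close> is the larger side, so p = j and q = i, and the rows
      exchange roles: row two restricts \<open>t\<close> against \<open>p\<close>, row three
      \<open>q\<close> against \<open>t\<close>. Interchanging the sums over \<open>p\<close> and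
      \<open>q\<close> then gives the previous expression.\<close>
    have "(\<Sum>t\<le>i + j. (i + j choose t) * of_bool (balanced ?n (k + 1) \<and>
        balanced ?n (t + (k - j)) \<and> balanced ?n (i + j - t + (k - j)))) = ?T j i"
      if "j \<in> {..k}" for i j
      unfolding balanced_odd add.commute[of i j] using that
      by (intro sum.cong refl arg_cong2[where f = "(*)"] arg_cong[where f = of_bool]) auto
    moreover have "?n - (k + 1) = k" by simp
    ultimately have "G (k + 1) = (\<Sum>q\<le>k + 1. (k + 1 choose q) * (\<Sum>p\<le>k. (k choose p) * ?T p q))"
      unfolding G_def by (simp only: cong: sum.cong)
    also have "\<dots> = (\<Sum>p\<le>k. (k choose p) * (\<Sum>q\<le>k + 1. (k + 1 choose q) * ?T p q))"
      unfolding sum_distrib_left by (subst sum.swap) (simp only: mult.left_commute)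
    finally show ?thesis using S by simp
  qed
  finally show ?thesis by simp
qed

theorem theorem1:
  fixes n k :: nat
  assumes "n \<ge> 1"
  shows "(n = 2 * k \<longrightarrow>
            alpha 3 (2 * k) = (\<Sum>i=0..k. multinomial n (k - i) (k - i) i i * (2 * i choose i)) \<and>
            (\<Sum>i=0..k. multinomial n (k - i) (k - i) i i * (2 * i choose i)) =
              (n choose k) * (\<Sum>i=0..k. (k choose i)^2 * (2 * i choose i))) \<and>
         (n = 2 * k + 1 \<longrightarrow>
            alpha 3 (2 * k + 1) =
              2 * (n choose k) *
              (\<Sum>i=0..k. (k choose i) *
                 ((2 * i + 1 choose (i + 1)) * (k + 1 choose i) +
                  2 * (k + 1 choose (i + 1)) * (2 * i + 1 choose i))))"
proof -
  have "(\<Sum>i=0..k. multinomial (2 * k) (k - i) (k - i) i i * (2 * i choose i)) =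
      (2 * k choose k) * (\<Sum>i=0..k. (k choose i)\<^sup>2 * (2 * i choose i))"
    by (simp add: multinomial_eq sum_distrib_left mult.assoc)
  then show ?thesis using alpha_3_even[of k] alpha_3_odd[of k] by (intro conjI impI) (simp_all only:)
qed

end
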